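(* For every integer $n\ge 0$, the following two identities hold as identities of rational functions in the indeterminate $q$: \[ \sum_{(h_0,h_1,\ldots,h_{2n})\in\mathcal{D}_n}\ \prod_{i=1}^{2n}\frac{q^{h_i}}{1-q^{2h_i+1-\delta_{h_i,i}}}=\frac{E^*_{2n}(q)}{(q;q)_{2n}}, \] \[ \sum_{(h_0,h_1,\ldots,h_{2n})\in\mathcal{D}_n}\ \prod_{i=1}^{2n}\frac{q^{h_i-\delta_{h_i,i}}}{1-q^{2h_i+1-\delta_{h_i,i}}}=\frac{E_{2n}(q)}{(q;q)_{2n}}, \] where $\delta_{i,j}$ is the Kronecker delta.
   Context: $\mathcal{D}_n$ is the set of Dyck paths of length $2n$, each encoded by its sequence of heights: $\mathcal{D}_n$ consists of the integer sequences $(h_0,h_1,\ldots,h_{2n})$ with $h_0=h_{2n}=0$, $h_i\ge 0$ for all $i$, and $|h_i-h_{i+1}|=1$ for all $0\le i<2n$. $(a;q)_n=\prod_{i=0}^{n-1}(1-aq^i)$, so $(q;q)_{m}=\prod_{i=1}^{m}(1-q^i)$. For $\sigma\in\mathfrak{S}_n$ (permutations of $\{1,\ldots,n\}$), the descent set is $D(\sigma)=\{i\in\{1,\ldots,n-1\}:\sigma_i>\sigma_{i+1}\}$, and the major index is $\mathrm{maj}(\sigma)=\sum_{i\in D(\sigma)}i$. The permutation $\sigma$ is alternating if $\sigma_1>\sigma_2<\sigma_3>\cdots$ (its descent set is the set of odd elements of $\{1,\ldots,n-1\}$), and reverse alternating if $\sigma_1<\sigma_2>\sigma_3<\cdots$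 (its descent set is the set of even elements of $\{1,\ldots,n-1\}$). $\mathrm{Alt}_n$ and $\mathrm{RevAlt}_n$ denote the sets of alternating and reverse alternating permutations in $\mathfrak{S}_n$ respectively. Define \[ E_n(q)=\sum_{\sigma\in \mathrm{RevAlt}_n}q^{\mathrm{maj}(\sigma^{-1})},\qquad E_n^*(q)=\sum_{\sigma\in \mathrm{Alt}_n}q^{\mathrm{maj}(\sigma^{-1})}. \] For $n=0$ the unique (empty) permutation is counted in both, so $E_0(q)=E_0^*(q)=1$; empty products equal $1$. *)

theory Defs
  imports
    "HOL-Combinatorics.Combinatorics"
    "HOL-Computational_Algebra.Computational_Algebra"
begin

definition dyck_paths :: "nat \<Rightarrow> int list set" where
  "dyck_paths n = {h. length h = 2 * n + 1 \<and> h ! 0 = 0 \<and> h ! (2 * n) = 0 \<and>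
     (\<forall>i\<le>2 * n. h ! i \<ge> 0) \<and> (\<forall>i<2 * n. \<bar>h ! i - h ! (i + 1)\<bar> = 1)}"

text \<open>Finiteness matters because a sum over an infinite set would be 0 by convention.\<close>

lemma finite_dyck_paths: "finite (dyck_paths n)"
proof (rule finite_subset)
  show "finite {h :: int list. set h \<subseteq> {0..2 * int n} \<and> length h = 2 * n + 1}"
    by (rule finite_lists_length_eq) simp
  show "dyck_paths n \<subseteq> {h. set h \<subseteq> {0..2 * int n} \<and> length h = 2 * n + 1}"
  proof
    fix h assume h: "h \<in> dyck_paths n"
    have le: "h ! i \<le> int i" if "i \<le> 2 * n" for i
      using that
    proof (induction i)
      case 0
      then show ?case using h by (simp add: dyck_paths_def)
    next
      case (Suc i)
      then have "\<bar>h ! i - h ! (i + 1)\<bar> = 1" "h ! i \<le> int i"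
        using h by (auto simp: dyck_paths_def)
      then show ?case by simp
    qed
    have "x \<in> {0..2 * int n}" if "x \<in> set h" for x
    proof -
      obtain i where i: "i < length h" "x = h ! i"
        using \<open>x \<in> set h\<close> by (auto simp: in_set_conv_nth)
      then have "i \<le> 2 * n" using h by (simp add: dyck_paths_def)
      then show ?thesis using le[of i] h i by (auto simp: dyck_paths_def)
    qed
    then show "h \<in> {h. set h \<subseteq> {0..2 * int n} \<and> length h = 2 * n + 1}"
      using h by (auto simp: dyck_paths_def)
  qed
qed

definition q_pochhammer :: "'a::comm_ring_1 \<Rightarrow> 'a \<Rightarrow> nat \<Rightarrow> 'a" where
  "q_pochhammer a q n = (\<Prod>i<n. 1 - a * q ^ i)"

text \<open>A permutation of \<open>{1..n}\<close> is a function \<open>\<sigma>\<close> with \<open>\<sigma> permutes {1..n}\<close>, so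
  that \<open>\<sigma>\<close> is the identity outside \<open>{1..n}\<close> and \<open>inv \<sigma>\<close> is the inverse permutation.\<close>

definition descent_set :: "nat \<Rightarrow> (nat \<Rightarrow> nat) \<Rightarrow> nat set" where
  "descent_set n \<sigma> = {i \<in> {1..<n}. \<sigma> i > \<sigma> (i + 1)}"

definition maj :: "nat \<Rightarrow> (nat \<Rightarrow> nat) \<Rightarrow> nat" where
  "maj n \<sigma> = \<Sum>(descent_set n \<sigma>)"

definition Alt :: "nat \<Rightarrow> (nat \<Rightarrow> nat) set" where
  "Alt n = {\<sigma>. \<sigma> permutes {1..n} \<and> descent_set n \<sigma> = {i \<in> {1..<n}. odd i}}"

definition RevAlt :: "nat \<Rightarrow> (nat \<Rightarrow> nat) set" where
  "RevAlt n = {\<sigma>. \<sigma> permutes {1..n} \<and> descent_set n \<sigma> = {i \<in> {1..<n}. even i}}"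

definition E :: "nat \<Rightarrow> 'a::comm_ring_1 \<Rightarrow> 'a" where
  "E n q = (\<Sum>\<sigma>\<in>RevAlt n. q ^ maj n (inv \<sigma>))"

definition Estar :: "nat \<Rightarrow> 'a::comm_ring_1 \<Rightarrow> 'a" where
  "Estar n q = (\<Sum>\<sigma>\<in>Alt n. q ^ maj n (inv \<sigma>))"

text \<open>The indeterminate, as an element of the field of rational functions over the rationals.\<close>

definition indet :: "rat poly fract" where
  "indet = Fract [:0, 1:] 1"

definition kdelta :: "int \<Rightarrow> int \<Rightarrow> int" where
  "kdelta i j = (if i = j then 1 else 0)"

end

theory Submission
  imports Defs
begin

text \<open>
  Write \<open>w\<^sub>h = q\<^sup>h / (1 - q^(2h+1))\<close> for the weight of a vertex that is not on the initial ascent and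
  \<open>v\<^sub>h\<close> for that of a vertex on it. The series
  \<open>C\<^sub>h = \<Sum>\<^sub>j (-1)^j c(h,j) Y^j\<close> with
  \<open>c(h,j) = q^(h choose 2) (q\<^sup>2;q\<^sup>2)\<^sub>j\<^sub>+\<^sub>h / ((q\<^sup>2;q\<^sup>2)\<^sub>j (q;q)\<^sub>2\<^sub>j\<^sub>+\<^sub>2\<^sub>h)\<close>
  (times \<open>q^(j(2j+2h-1))\<close> for the starred identity) satisfy
  \<open>C\<^sub>h = C\<^sub>h\<^sub>+\<^sub>1 / w\<^sub>h - Y C\<^sub>h\<^sub>+\<^sub>2\<close>, which is the recurrence of the generating functions of walks
  from height \<open>h\<close> to \<open>0\<close> under the weights \<open>w\<close>: these equal \<open>C\<^sub>h\<^sub>+\<^sub>1 / (w\<^sub>h C\<^sub>0)\<close>. Splitting a Dyck path at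
  the end of its initial ascent multiplies its generating function by \<open>C\<^sub>0\<close> into
  \<open>\<Sum>\<^sub>k v\<^sub>1 \<dots> v\<^sub>k Y\<^sup>k C\<^sub>k\<close>, which is \<open>1\<close> by the finite q-binomial theorem in base \<open>q\<^sup>2\<close>. On the permutation
  side, the distribution of the major index over shuffles shows that the number of permutations with
  prescribed descents, counted by the major index of the inverse, multiplies like ribbon Schur functions.
  Inclusion-exclusion over a monotone initial block of length \<open>2j\<close> then gives the same inverse \<open>C\<^sub>0\<close>.
\<close>

text \<open>The major index of the reversed word, computed from the front.\<close>

fun rmaj :: "nat list \<Rightarrow> nat" where
  "rmaj (x # y # w) = (if x < y then Suc (length w) else 0) + rmaj (y # w)"
| "rmaj _ = 0"

section \<open>q-factorials and Gaussian binomials for a parameter that is not a root of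
  unity\<close>

text \<open>Stated for any such \<open>q\<close>, so that the results also apply in base
  \<open>q^2\<close>.\<close>

locale generic_q =
  fixes q :: "'a::field"
  assumes q_nonzero: "q \<noteq> 0" and q_power_neq_1: "i > 0 \<Longrightarrow> q ^ i \<noteq> 1"
begin

abbreviation qfact :: "nat \<Rightarrow> 'a" where
  "qfact n \<equiv> q_pochhammer q q n"

lemma qfact_0 [simp]: "qfact 0 = 1"
  by (simp add: q_pochhammer_def)

lemma qfact_Suc: "qfact (Suc n) = qfact n * (1 - q ^ Suc n)"
  by (simp add: q_pochhammer_def)

lemma one_minus_power_nonzero: "i > 0 \<Longrightarrow> 1 - q ^ i \<noteq> 0"
  using q_power_neq_1[of i] by auto

lemma qfact_nonzero [simp]: "qfact n \<noteq> 0"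
proof (induction n)
  case (Suc n)
  then show ?case using one_minus_power_nonzero[of "Suc n"] by (simp only: qfact_Suc) simp
qed simp

text \<open>The Gaussian binomial coefficient of \<open>a + b\<close> over \<open>a\<close>; taking
  the two parts as arguments makes it symmetric and its recurrences free of subtraction.\<close>

definition qbin :: "nat \<Rightarrow> nat \<Rightarrow> 'a" where
  "qbin a b = qfact (a + b) / (qfact a * qfact b)"

lemma qbin_0 [simp]: "qbin 0 b = 1" "qbin a 0 = 1"
  by (simp_all add: qbin_def)

lemma qbin_commute: "qbin a b = qbin b a"
  by (simp add: qbin_def add.commute mult.commute)

lemma qbin_Suc_Suc: "qbin (Suc a) (Suc b) = qbin (Suc a) b + q ^ Suc b * qbin a (Suc b)"
proof -
  define x y z where "x = qfact a" and "y = qfact b" and "z = qfact (a + b + 1)"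
  define s t where "s = 1 - q ^ Suc a" and "t = 1 - q ^ Suc b"
  have nz: "x \<noteq> 0" "y \<noteq> 0" "s \<noteq> 0" "t \<noteq> 0"
    unfolding x_def y_def s_def t_def using one_minus_power_nonzero[of "Suc a"] one_minus_power_nonzero[of "Suc b"]
    by simp_all
  have "qfact (Suc a + Suc b) = z * (1 - q ^ Suc b * q ^ Suc a)"
    using qfact_Suc[of "a + b + 1"] by (simp add: z_def power_add mult_ac)
  then have 1: "qbin (Suc a) (Suc b) = z * (1 - q ^ Suc b * q ^ Suc a) / (x * s * (y * t))"
    unfolding qbin_def qfact_Suc[of a] qfact_Suc[of b] by (simp only: x_def y_def s_def t_def)
  have 2: "qbin (Suc a) b = z / (x * s * y)"
    by (simp add: qbin_def x_def y_def z_def s_def qfact_Suc[of a])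
  have 3: "qbin a (Suc b) = z / (x * (y * t))"
    by (simp add: qbin_def x_def y_def z_def t_def qfact_Suc[of b])
  \<comment> \<open>Each summand cancels one factor of the denominator, which leaves the two terms
    of the q-Pascal rule.\<close>
  have 4: "1 - q ^ Suc b * q ^ Suc a = t + q ^ Suc b * s"
    by (simp add: s_def t_def algebra_simps)
  show ?thesis unfolding 1 2 3 4 using nz by (simp add: field_simps)
qed

lemma qbin_Suc_Suc': "qbin (Suc a) (Suc b) = qbin a (Suc b) + q ^ Suc a * qbin (Suc a) b"
  by (metis qbin_Suc_Suc qbin_commute)

text \<open>The q-binomial theorem for \<open>(x;q)_m\<close> at \<open>x = 1\<close> and
  \<open>m > 0\<close>, where the factor \<open>1 - x\<close> vanishes. In the proof, the sum for
  \<open>N + 1\<close> is \<open>1 - q^N\<close> times the sum for \<open>N\<close>, and this factor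
  is 0 for \<open>N = 0\<close>.\<close>

lemma alternating_qbin_sum:
  "(\<Sum>k\<le>Suc N. (-1) ^ k * q ^ (k choose 2) * qbin k (Suc N - k)) = 0"
proof -
  let ?S = "\<lambda>N. \<Sum>k\<le>N. (-1) ^ k * q ^ (k choose 2) * qbin k (N - k)"
  have "?S (Suc N) = (1 - q ^ N) * ?S N" for N
  proof -
    let ?f = "\<lambda>k. (-1) ^ k * q ^ (k choose 2) * qbin k (N - k)"
    \<comment> \<open>q-Pascal splits a term into the term of the shorter sum at
      \<open>k + 1\<close> and \<open>-q^N\<close> times the one at \<open>k\<close>; for
      \<open>k = N\<close> only the second piece exists.\<close>
    have "(-1) ^ Suc k * q ^ (Suc k choose 2) * qbin (Suc k) (Suc N - Suc k)
          = (if k < N then ?f (Suc k) else 0) - q ^ N * ?f k" if "k \<le> N" for k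
    proof (cases "k < N")
      case True
      then obtain b where b: "N = k + Suc b" using less_imp_Suc_add by auto
      have "Suc k choose 2 = (k choose 2) + k" by (simp add: numeral_2_eq_2)
      then show ?thesis
        by (simp add: b qbin_Suc_Suc power_add algebra_simps)
    next
      case False
      then have "k = N" using that by simp
      moreover have "Suc k choose 2 = (k choose 2) + k" by (simp add: numeral_2_eq_2)
      ultimately show ?thesis by (simp add: power_add)
    qed
    then have "?S (Suc N) = 1 + (\<Sum>k\<le>N. (if k < N then ?f (Suc k) else 0) - q ^ N * ?f k)"
      by (subst sum.atMost_Suc_shift) (simp add: numeral_2_eq_2)
    also have "\<dots> = (1 + (\<Sum>k\<le>N. if k < N then ?f (Suc k) else 0)) - q ^ N * ?S N"
      by (simp add: sum_subtractf sum_distrib_left)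
    also have "(\<Sum>k\<le>N. if k < N then ?f (Suc k) else 0) = (\<Sum>k<N. ?f (Suc k))"
      by (intro sum.mono_neutral_cong_right) auto
    also have "1 + \<dots> = ?S N"
      by (subst sum.atMost_shift) (simp add: numeral_2_eq_2)
    finally show ?thesis by (simp add: algebra_simps)
  qed
  then have "?S (Suc N) = (1 - q ^ N) * ?S N" .
  moreover have "?S (Suc N) = 0" if "?S N = 0 \<or> N = 0"
    using that calculation by auto
  moreover have "?S N = 0 \<or> N = 0"
  proof (induction N)
    case (Suc N)
    then show ?case using \<open>\<And>N. ?S (Suc N) = (1 - q ^ N) * ?S N\<close>[of N] by auto
  qed simp
  ultimately show ?thesis by blast
qed

lemma alternating_qbin_sum':
  "(\<Sum>k\<le>N. (-1) ^ k * q ^ (k choose 2) * qbin k (N - k)) = (if N = 0 then 1 else 0)"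
  using alternating_qbin_sum[of "N - 1"] by (cases N) (simp_all add: numeral_2_eq_2)

section \<open>Distribution of the major index over shuffles\<close>

text \<open>The effect of a new front letter on \<open>rmaj\<close> depends on the letter after it,
  so the plain shuffle sum has no recursion of its own. With the front letter \<open>a\<close> fixed
  there is one: the next letter is \<open>b\<close> or the head of \<open>u\<close>, and q-Pascal
  combines the two cases.\<close>

lemma shuffle_sum_first:
  assumes "set (a # u) \<inter> set (b # v) = {}"
  shows "(\<Sum>w\<in>shuffles u (b # v). q ^ rmaj (a # w))
    = q ^ (rmaj (a # u) + rmaj (b # v)) * (if b < a then 1 else q ^ Suc (length v))
      * qbin (length u) (Suc (length v))"
  using assms
proof (induction "length u + length v" arbitrary: a u b v rule: less_induct)
  case less
  show ?case
  proof (cases u)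
    case Nil
    then show ?thesis using less.prems by (auto simp: power_add)
  next
    case (Cons c x)
    let ?r = "\<lambda>w. q ^ rmaj w"
    have neq: "b \<noteq> c" "a \<noteq> b" using less.prems Cons by auto
    have "shuffles u (b # v) = (#) c ` shuffles x (b # v) \<union> (#) b ` shuffles u v"
      by (simp add: Cons)
    then have "(\<Sum>w\<in>shuffles u (b # v). ?r (a # w))
        = (\<Sum>w\<in>(#) c ` shuffles x (b # v). ?r (a # w)) + (\<Sum>w\<in>(#) b ` shuffles u v. ?r (a # w))"
      using neq by (simp only:, subst sum.union_disjoint) auto
    also have "\<dots> = (\<Sum>w\<in>shuffles x (b # v). ?r (a # c # w)) + (\<Sum>w\<in>shuffles u v. ?r (a # b # w))"
      by (simp add: sum.reindex del: rmaj.simps)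
    also have "(\<Sum>w\<in>shuffles x (b # v). ?r (a # c # w))
        = (if a < c then q ^ (length u + Suc (length v)) else 1) * (\<Sum>w\<in>shuffles x (b # v). ?r (c # w))"
      unfolding sum_distrib_left
      by (intro sum.cong refl) (auto simp: power_add length_shuffles Cons)
    also have "(\<Sum>w\<in>shuffles x (b # v). ?r (c # w)) = q ^ (rmaj u + rmaj (b # v))
       * (if b < c then 1 else q ^ Suc (length v)) * qbin (length x) (Suc (length v))"
      unfolding Cons by (rule less.hyps) (use less.prems Cons in auto)
    also have "(\<Sum>w\<in>shuffles u v. ?r (a # b # w))
        = (if a < b then q ^ (length u + Suc (length v)) else 1) * (\<Sum>w\<in>shuffles v u. ?r (b # w))"
      unfolding sum_distrib_left shuffles_commutes[of v]
      by (intro sum.cong refl) (auto simp: power_add length_shuffles Cons)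
    \<comment> \<open>Here \<open>b\<close> is the front letter, so the induction hypothesis applies
      with the two lists exchanged.\<close>
    also have "(\<Sum>w\<in>shuffles v u. ?r (b # w)) = q ^ (rmaj (b # v) + rmaj u)
       * (if c < b then 1 else q ^ length u) * qbin (length v) (length u)"
      unfolding Cons list.size(4) add_0_right One_nat_def add_Suc_right
      by (rule less.hyps) (use less.prems Cons in auto)
    also have "qbin (length v) (length u) = qbin (length u) (length v)"
      by (rule qbin_commute)
    finally have *: "(\<Sum>w\<in>shuffles u (b # v). ?r (a # w)) = q ^ (rmaj u + rmaj (b # v)) * 
       ((if a < c then q ^ (length u + Suc (length v)) else 1) * (if b < c then 1 else q ^ Suc (length v)) * qbin (length x) (Suc (length v))
       + (if a < b then q ^ (length u + Suc (length v)) else 1) * (if c < b then 1 else q ^ length u) * qbin (length u) (length v))"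
      by (simp add: algebra_simps)
    have r: "q ^ (rmaj (a # u) + rmaj (b # v)) = q ^ (rmaj u + rmaj (b # v)) * (if a < c then q ^ length u else 1)"
      by (simp add: Cons power_add)
    have L: "length u = Suc (length x)" by (simp add: Cons)
    have "(if a < c then q ^ (length u + Suc (length v)) else 1) * (if b < c then 1 else q ^ Suc (length v)) * qbin (length x) (Suc (length v))
       + (if a < b then q ^ (length u + Suc (length v)) else 1) * (if c < b then 1 else q ^ length u) * qbin (length u) (length v)
       = (if a < c then q ^ length u else 1) * (if b < a then 1 else q ^ Suc (length v)) * qbin (length u) (Suc (length v))"
    proof -
      define X Y Z K M where "X = qbin (length x) (Suc (length v))" and "Y = qbin (length u) (length v)"
        and "Z = qbin (length u) (Suc (length v))" and "K = q ^ length u" and "M = q ^ Suc (length v)"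
      \<comment> \<open>The relative order of \<open>a\<close>, \<open>b\<close>, \<open>c\<close>
        decides which form of q-Pascal closes a case.\<close>
      have 1: "Z = Y + M * X" and 2: "Z = X + K * Y"
        unfolding X_def Y_def Z_def K_def M_def L by (rule qbin_Suc_Suc, rule qbin_Suc_Suc')
      have "(if a < c then K * M else 1) * (if b < c then 1 else M) * X
         + (if a < b then K * M else 1) * (if c < b then 1 else K) * Y
         = (if a < c then K else 1) * (if b < a then 1 else M) * Z"
      proof (cases "b < a")
        case True
        show ?thesis
        proof (cases "b < c")
          case True
          then show ?thesis using \<open>b < a\<close> 1 2 by (simp add: algebra_simps)
        next
          case False
          then show ?thesis using \<open>b < a\<close> neq 1 by (simp add: algebra_simps)
        qed
      next
        case False
        show ?thesis
        proof (cases "b < c")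
          case True
          then show ?thesis using \<open>\<not> b < a\<close> neq 2 by (simp add: algebra_simps)
        next
          case False
          show ?thesis
          proof (cases "a < c")
            case True
            then show ?thesis using \<open>\<not> b < a\<close> \<open>\<not> b < c\<close> neq 1 by (simp add: algebra_simps)
          next
            case False
            then show ?thesis using \<open>\<not> b < a\<close> \<open>\<not> b < c\<close> neq 2 by (simp add: algebra_simps)
          qed
        qed
      qed
      then show ?thesis
        unfolding X_def Y_def Z_def K_def M_def power_add .
    qed
    then show ?thesis unfolding * r by (simp add: mult.assoc)
  qed
qed

text \<open>The two possible first letters give two instances of \<open>shuffle_sum_first\<close>,
  which q-Pascal adds up. This is the shuffle theorem of Garsia and Gessel.\<close>

lemma shuffle_sum:
  assumes "set u \<inter> set v = {}"
  shows "(\<Sum>w\<in>shuffles u v. q ^ rmaj w) = q ^ (rmaj u + rmaj v) * qbin (length u) (length v)"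
proof (cases u; cases v)
  fix a u' b v'
  assume uv: "u = a # u'" "v = b # v'"
  have neq: "a \<noteq> b" using assms uv by auto
  have "shuffles u v = (#) a ` shuffles u' v \<union> (#) b ` shuffles u v'"
    by (simp add: uv)
  then have "(\<Sum>w\<in>shuffles u v. q ^ rmaj w)
     = (\<Sum>w\<in>(#) a ` shuffles u' v. q ^ rmaj w) + (\<Sum>w\<in>(#) b ` shuffles u v'. q ^ rmaj w)"
    using neq by (simp only:, subst sum.union_disjoint) auto
  also have "\<dots> = (\<Sum>w\<in>shuffles u' v. q ^ rmaj (a # w)) + (\<Sum>w\<in>shuffles v' u. q ^ rmaj (b # w))"
    unfolding shuffles_commutes[of v' u] by (simp add: sum.reindex del: rmaj.simps)
  also have "(\<Sum>w\<in>shuffles u' v. q ^ rmaj (a # w)) = q ^ (rmaj u + rmaj v)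
     * (if b < a then 1 else q ^ length v) * qbin (length u') (length v)"
    unfolding uv using shuffle_sum_first[of a u' b v'] assms uv by simp
  also have "(\<Sum>w\<in>shuffles v' u. q ^ rmaj (b # w)) = q ^ (rmaj v + rmaj u)
     * (if a < b then 1 else q ^ length u) * qbin (length v') (length u)"
    unfolding uv using shuffle_sum_first[of b v' a u'] assms uv by (simp add: Int_commute)
  also have "qbin (length v') (length u) = qbin (length u) (length v')"
    by (rule qbin_commute)
  finally have sum: "(\<Sum>w\<in>shuffles u v. q ^ rmaj w) = q ^ (rmaj u + rmaj v)
      * ((if b < a then 1 else q ^ length v) * qbin (length u') (length v)
       + (if a < b then 1 else q ^ length u) * qbin (length u) (length v'))"
    by (simp add: algebra_simps)
  show ?thesis
  proof (cases "b < a")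
    case True
    then show ?thesis unfolding sum using qbin_Suc_Suc'[of "length u'" "length v'"] by (simp add: uv)
  next
    case False
    then show ?thesis unfolding sum using neq qbin_Suc_Suc[of "length u'" "length v'"] by (simp add: uv add.commute)
  qed
qed auto

end

section \<open>Weighted walks and their generating functions\<close>

definition walks :: "nat \<Rightarrow> int \<Rightarrow> int list set" where
  "walks m h = {l. length l = Suc m \<and> l ! 0 = h \<and> l ! m = 0 \<and>
     (\<forall>i\<le>m. l ! i \<ge> 0) \<and> (\<forall>i<m. \<bar>l ! i - l ! (i + 1)\<bar> = 1)}"

text \<open>\<open>i\<close> is the index of the current vertex, kept because weights differ on and
  off the initial ascent. The starting vertex carries no weight.\<close>

fun walk_sum :: "(nat \<Rightarrow> int \<Rightarrow> 'a::comm_ring_1) \<Rightarrow> nat \<Rightarrow> nat \<Rightarrow> int \<Rightarrow> 'a" where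
  "walk_sum W i 0 h = (if h = 0 then 1 else 0)"
| "walk_sum W i (Suc m) h =
     (if h > 0 then W (Suc i) (h - 1) * walk_sum W (Suc i) m (h - 1) else 0)
     + W (Suc i) (h + 1) * walk_sum W (Suc i) m (h + 1)"

lemma walks_0: "walks 0 h = (if h = 0 then {[0]} else {})"
  by (auto simp: walks_def length_Suc_conv)

lemma walks_neg: "h < 0 \<Longrightarrow> walks m h = {}"
  by (auto simp: walks_def)

lemma walks_Suc:
  assumes "h \<ge> 0"
  shows "walks (Suc m) h = (#) h ` (walks m (h - 1) \<union> walks m (h + 1))" (is "?L = ?R")
proof
  show "?L \<subseteq> ?R"
  proof
    fix l assume "l \<in> ?L"
    then obtain t where t: "l = h # t" "length t = Suc m"
      by (auto simp: walks_def length_Suc_conv)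
    have "t ! m = 0" "\<forall>i\<le>m. t ! i \<ge> 0" "\<bar>h - t ! 0\<bar> = 1" "\<forall>i<m. \<bar>t ! i - t ! (i + 1)\<bar> = 1"
      using \<open>l \<in> ?L\<close> by (force simp: walks_def t)+
    then have "t \<in> walks m (h - 1) \<union> walks m (h + 1)"
      using t by (auto simp: walks_def)
    then show "l \<in> ?R" using t by blast
  qed
  show "?R \<subseteq> ?L"
    using assms by (auto simp: walks_def nth_Cons split: nat.split)
qed

lemma finite_walks: "finite (walks m h)"
proof (induction m arbitrary: h)
  case (Suc m)
  then show ?case by (cases "h < 0") (simp_all add: walks_neg walks_Suc)
qed (simp add: walks_0)

lemma sum_walks:
  assumes "h \<ge> 0"
  shows "(\<Sum>l\<in>walks m h. \<Prod>k=1..m. W (i + k) (l ! k)) = walk_sum W i m h"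
  using assms
proof (induction m arbitrary: i h)
  case (Suc m)
  let ?f = "\<lambda>i m l. \<Prod>k=1..m. W (i + k) (l ! k)"
  have Cons: "?f i (Suc m) (h # l) = W (Suc i) g * ?f (Suc i) m l" if "l \<in> walks m g" for l g
  proof -
    have "?f i (Suc m) (h # l) = (\<Prod>k=0..m. W (Suc (i + k)) (l ! k))"
      using prod.shift_bounds_cl_Suc_ivl[of "\<lambda>k. W (i + k) ((h # l) ! k)" 0 m] by simp
    also have "\<dots> = W (Suc i) (l ! 0) * (\<Prod>k=Suc 0..m. W (Suc (i + k)) (l ! k))"
      by (subst prod.atLeast_Suc_atMost) simp_all
    finally show ?thesis using that by (simp add: walks_def)
  qed
  have part: "(\<Sum>l\<in>(#) h ` walks m g. ?f i (Suc m) l) = W (Suc i) g * (\<Sum>l\<in>walks m g. ?f (Suc i) m l)" for g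
    unfolding sum_distrib_left
    by (subst sum.reindex) (simp, simp only: comp_def, intro sum.cong refl Cons)
  have "walks m (h - 1) \<inter> walks m (h + 1) = {}"
    by (auto simp: walks_def)
  then have "(\<Sum>l\<in>walks (Suc m) h. ?f i (Suc m) l)
    = (\<Sum>l\<in>(#) h ` walks m (h - 1). ?f i (Suc m) l) + (\<Sum>l\<in>(#) h ` walks m (h + 1). ?f i (Suc m) l)"
    unfolding walks_Suc[OF Suc.prems] image_Un
    by (intro sum.union_disjoint finite_imageI finite_walks) auto
  then show ?case
    unfolding part using Suc.IH[of "h - 1" "Suc i"] Suc.IH[of "h + 1" "Suc i"] Suc.prems
    by (cases "h = 0") (simp_all add: walks_neg del: prod.cl_ivl_Suc)
qed (simp add: walks_0)

lemma dyck_paths_eq_walks: "dyck_paths n = walks (2 * n) 0"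
  by (auto simp: dyck_paths_def walks_def)

lemma walk_sum_eq_0: "int m < h \<Longrightarrow> walk_sum W i m h = 0"
  by (induction m arbitrary: i h) auto

text \<open>The height grows by at most one while the index grows by one, so a walk below the
  diagonal \<open>h = i\<close> stays below it and meets only weights that ignore the index.\<close>

lemma walk_sum_off_diagonal:
  assumes "\<And>i h. int i > h \<Longrightarrow> W i h = w h" and "int i > h"
  shows "walk_sum W i m h = walk_sum (\<lambda>_. w) j m h"
  using assms(2)
proof (induction m arbitrary: i j h)
  case (Suc m)
  then have "walk_sum W (Suc i) m g = walk_sum (\<lambda>_. w) (Suc j) m g" if "g \<le> h + 1" for g
    using that by auto
  with Suc.prems show ?case by (simp add: assms(1))
qed simp


text \<open>A walk from \<open>h\<close> to 0 with \<open>r\<close> up steps has length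
  \<open>h + 2 * r\<close>; the variable marks the up steps.\<close>

definition walk_fps :: "(nat \<Rightarrow> int \<Rightarrow> 'a::comm_ring_1) \<Rightarrow> nat \<Rightarrow> nat \<Rightarrow> 'a fps" where
  "walk_fps W i h = Abs_fps (\<lambda>r. walk_sum W i (h + 2 * r) (int h))"

lemma walk_fps_0:
  "walk_fps W i 0 = 1 + fps_X * fps_const (W (Suc i) (int (Suc 0))) * walk_fps W (Suc i) (Suc 0)"
proof (rule fps_ext)
  fix n
  show "walk_fps W i 0 $ n = (1 + fps_X * fps_const (W (Suc i) (int (Suc 0))) * walk_fps W (Suc i) (Suc 0)) $ n"
    by (cases n) (simp_all add: walk_fps_def mult.assoc)
qed

lemma walk_fps_Suc:
  "walk_fps W i (Suc h) = fps_const (W (Suc i) (int h)) * walk_fps W (Suc i) h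
    + fps_X * fps_const (W (Suc i) (int (Suc (Suc h)))) * walk_fps W (Suc i) (Suc (Suc h))"
proof (rule fps_ext)
  fix n
  show "walk_fps W i (Suc h) $ n = (fps_const (W (Suc i) (int h)) * walk_fps W (Suc i) h
    + fps_X * fps_const (W (Suc i) (int (Suc (Suc h)))) * walk_fps W (Suc i) (Suc (Suc h))) $ n"
    \<comment> \<open>For \<open>n = 0\<close> no up step is available: from the upper neighbour the
      remaining steps cannot reach 0.\<close>
    by (cases n) (simp_all add: walk_fps_def mult.assoc walk_sum_eq_0 add.commute)
qed

lemma walk_fps_off_diagonal:
  assumes "\<And>i h. int i > h \<Longrightarrow> W i h = w h" and "i > h"
  shows "walk_fps W i h = walk_fps (\<lambda>_. w) j h"
  unfolding walk_fps_def using walk_sum_off_diagonal[of W w "int h" i _ j] assms by simp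


section \<open>q-Bessel series and walks off the initial ascent\<close>

context generic_q
begin

lemma generic_q_square: "generic_q (q\<^sup>2)"
  using q_nonzero q_power_neq_1 by unfold_locales (simp_all flip: power_mult)

interpretation sq: generic_q "q\<^sup>2"
  by (rule generic_q_square)

lemma qfact_square_Suc: "sq.qfact (Suc j) = sq.qfact j * (1 - q ^ (2 * j + 2))"
  unfolding sq.qfact_Suc power_mult[symmetric] by simp

definition step_weight :: "int \<Rightarrow> 'a" where
  "step_weight h = q powi h / (1 - q powi (2 * h + 1))"

text \<open>The truncated subtraction is harmless: it occurs only for \<open>j = 0\<close>, where the exponent is \<open>0\<close>.\<close>

definition bessel_coeff :: "bool \<Rightarrow> nat \<Rightarrow> nat \<Rightarrow> 'a" where
  "bessel_coeff star h j = (if star then q ^ (j * (2 * j + 2 * h - 1)) else 1) *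
     (q ^ (h choose 2) * sq.qfact (j + h) / (sq.qfact j * qfact (2 * j + 2 * h)))"

text \<open>As \<open>(q;q)_(2m) = (q;q^2)_m (q^2;q^2)_m\<close>, this is, up to normalization,
  Jackson's q-Bessel series of order \<open>h - 1/2\<close> in base \<open>q^2\<close>: the second
  one with the star, the first one without. For \<open>h = 0\<close> it is a q-cosine.\<close>

definition bessel :: "bool \<Rightarrow> nat \<Rightarrow> 'a fps" where
  "bessel star h = Abs_fps (\<lambda>j. (-1) ^ j * bessel_coeff star h j)"

text \<open>Here and in the next lemma a term of the recurrence becomes a rational multiple of a
  coefficient at height \<open>h\<close>, which reduces the recurrence to an identity of rational
  functions.\<close>

lemma bessel_coeff_Suc_height:
  "bessel_coeff star (Suc h) j / step_weight (int h)
    = (if star then q ^ (2 * j) else 1) * ((1 - q ^ (2 * h + 1)) / (1 - q ^ (2 * j + 2 * h + 1))) * bessel_coeff star h j"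
proof -
  have powi: "q powi (2 * int h + 1) = q ^ (2 * h + 1)"
    using power_int_of_nat[of q "2 * h + 1"] by (simp add: add.commute)
  have 1: "sq.qfact (j + Suc h) = sq.qfact (j + h) * (1 - q ^ (2 * j + 2 * h + 2))"
    using qfact_square_Suc[of "j + h"] by (simp add: algebra_simps)
  have 2: "qfact (2 * j + 2 * Suc h) = qfact (2 * j + 2 * h) * (1 - q ^ (2 * j + 2 * h + 1)) * (1 - q ^ (2 * j + 2 * h + 2))"
    using qfact_Suc[of "2 * j + 2 * h"] qfact_Suc[of "2 * j + 2 * h + 1"] by simp
  have 3: "Suc h choose 2 = (h choose 2) + h"
    by (simp add: numeral_2_eq_2)
  have 4: "j * (2 * j + 2 * Suc h - 1) = j * (2 * j + 2 * h - 1) + 2 * j"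
    by (cases j) (simp_all add: algebra_simps)
  have nz: "1 - q ^ (2 * j + 2 * h + 1) \<noteq> 0" "1 - q ^ (2 * j + 2 * h + 2) \<noteq> 0" "1 - q ^ (2 * h + 1) \<noteq> 0"
    by (rule one_minus_power_nonzero, simp)+
  show ?thesis
    unfolding bessel_coeff_def step_weight_def powi 1 2 3 4 power_int_of_nat power_add[of q "h choose 2"]
      power_add[of q _ "2 * j"]
    using nz q_nonzero by (simp add: divide_simps del: power_Suc add_2_eq_Suc')
qed

lemma bessel_coeff_Suc_Suc_height:
  "bessel_coeff star (Suc (Suc h)) j
    = (if star then 1 else q ^ (2 * h + 1)) * ((1 - q ^ (2 * Suc j)) / (1 - q ^ (2 * j + 2 * h + 3))) * bessel_coeff star h (Suc j)"
proof -
  have 1: "sq.qfact (Suc j) = sq.qfact j * (1 - q ^ (2 * Suc j))"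
    using sq.qfact_Suc[of j] by (simp only: power_mult)
  have 5: "sq.qfact (j + Suc (Suc h)) = sq.qfact (Suc j + h) * (1 - q ^ (2 * j + 2 * h + 4))"
    using qfact_square_Suc[of "Suc j + h"] by (simp only: add_Suc_right) (simp add: algebra_simps eval_nat_numeral)
  have 2: "qfact (2 * j + 2 * Suc (Suc h)) = qfact (2 * Suc j + 2 * h) * (1 - q ^ (2 * j + 2 * h + 3)) * (1 - q ^ (2 * j + 2 * h + 4))"
    using qfact_Suc[of "2 * j + 2 * h + 2"] qfact_Suc[of "2 * j + 2 * h + 3"] by (simp add: eval_nat_numeral)
  have 3: "Suc (Suc h) choose 2 = (h choose 2) + (2 * h + 1)"
    by (simp add: numeral_2_eq_2)
  have 4: "Suc j * (2 * Suc j + 2 * h - 1) = j * (2 * j + 2 * Suc (Suc h) - 1) + (2 * h + 1)"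
    by (cases j) (simp_all add: algebra_simps)
  have nz: "1 - q ^ (2 * j + 2 * h + 3) \<noteq> 0" "1 - q ^ (2 * j + 2 * h + 4) \<noteq> 0" "1 - q ^ (2 * Suc j) \<noteq> 0"
    by (rule one_minus_power_nonzero, simp)+
  show ?thesis
    unfolding bessel_coeff_def 1 2 3 4 5 power_add[of q "h choose 2"] power_add[of q "j * _" "2 * h + 1"]
    using nz q_nonzero by (simp add: divide_simps del: power_Suc add_2_eq_Suc')
qed

lemma bessel_recurrence:
  "fps_const (inverse (step_weight (int h))) * bessel star (Suc h)
    = bessel star h + fps_X * bessel star (Suc (Suc h))"
proof (rule fps_ext)
  fix j
  show "(fps_const (inverse (step_weight (int h))) * bessel star (Suc h)) $ j
    = (bessel star h + fps_X * bessel star (Suc (Suc h))) $ j"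
  proof (cases j)
    case 0
    have "1 - q ^ (2 * h + 1) \<noteq> 0" by (rule one_minus_power_nonzero) simp
    then have "bessel_coeff star (Suc h) 0 / step_weight (int h) = bessel_coeff star h 0"
      unfolding bessel_coeff_Suc_height by simp
    then show ?thesis by (simp add: 0 bessel_def field_simps)
  next
    case (Suc i)
    have e: "inverse (step_weight (int h)) * bessel_coeff star (Suc h) j = bessel_coeff star h j - bessel_coeff star (Suc (Suc h)) i"
    proof -
      \<comment> \<open>The claim becomes \<open>1 - C = (1 - C * A) - C * (1 - A)\<close> without
        the star and \<open>A * (1 - C) = (1 - C * A) - (1 - A)\<close> with it.\<close>
      define B A C where "B = bessel_coeff star h j" and "A = q ^ (2 * j)" and "C = q ^ (2 * h + 1)"
      have "1 - C * A \<noteq> 0"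
        unfolding A_def C_def power_add[symmetric] by (rule one_minus_power_nonzero) simp
      moreover have 1: "bessel_coeff star (Suc h) j / step_weight (int h) = (if star then A else 1) * ((1 - C) / (1 - C * A)) * B"
        unfolding bessel_coeff_Suc_height A_def B_def C_def by (simp add: power_add mult_ac)
      moreover have 2: "bessel_coeff star (Suc (Suc h)) i = (if star then 1 else C) * ((1 - A) / (1 - C * A)) * B"
        unfolding bessel_coeff_Suc_Suc_height A_def B_def C_def Suc
        by (simp add: power_add eval_nat_numeral mult_ac)
      ultimately show ?thesis unfolding divide_inverse_commute[symmetric] 1 2 B_def[symmetric]
        by (cases star; simp add: divide_simps; simp add: algebra_simps)
    qed
    show ?thesis
      using e by (simp add: Suc bessel_def mult.left_commute[of "inverse _"] right_diff_distrib)
  qed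
qed

lemma step_weight_nonzero: "step_weight (int h) \<noteq> 0"
proof -
  have "q powi (2 * int h + 1) = q ^ (2 * h + 1)"
    using power_int_of_nat[of q "2 * h + 1"] by (simp add: add.commute)
  then show ?thesis
    using one_minus_power_nonzero[of "2 * h + 1"] q_nonzero by (simp add: step_weight_def)
qed

text \<open>Both sides satisfy the same recursion, by the first step on the left and by
  \<open>bessel_recurrence\<close> on the right.\<close>

lemma walk_fps_mult_bessel:
  "walk_fps (\<lambda>_. step_weight) i h * bessel star 0
    = fps_const (inverse (step_weight (int h))) * bessel star (Suc h)"
proof (rule fps_ext)
  fix n
  let ?w = "\<lambda>h. step_weight (int h)"
  show "(walk_fps (\<lambda>_. step_weight) i h * bessel star 0) $ n
    = (fps_const (inverse (?w h)) * bessel star (Suc h)) $ n"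
  \<comment> \<open>This is the length of the walk, which either first step lowers by one.\<close>
  proof (induction "h + 2 * n" arbitrary: i h n rule: less_induct)
    case less
    have up: "(fps_X * fps_const (?w (Suc h)) * walk_fps (\<lambda>_. step_weight) (Suc i) (Suc h) * bessel star 0) $ n
      = (fps_X * bessel star (Suc (Suc h))) $ n"
    proof (cases n)
      case (Suc m)
      have "(walk_fps (\<lambda>_. step_weight) (Suc i) (Suc h) * bessel star 0) $ m
        = (fps_const (inverse (?w (Suc h))) * bessel star (Suc (Suc h))) $ m"
        by (rule less.hyps) (simp add: Suc)
      then show ?thesis
        using step_weight_nonzero[of "Suc h"] by (simp add: Suc mult.assoc)
    qed (simp add: mult.assoc)
    show ?case
    proof (cases h)
      case 0
      then show ?thesis
        unfolding bessel_recurrence using up by (simp add: walk_fps_0 distrib_right)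
    next
      case (Suc g)
      have "(walk_fps (\<lambda>_. step_weight) (Suc i) g * bessel star 0) $ n
        = (fps_const (inverse (?w g)) * bessel star (Suc g)) $ n"
        by (rule less.hyps) (simp add: Suc)
      then have "(fps_const (?w g) * walk_fps (\<lambda>_. step_weight) (Suc i) g * bessel star 0) $ n = bessel star h $ n"
        using step_weight_nonzero[of g] by (simp add: Suc mult.assoc)
      then show ?thesis
        unfolding bessel_recurrence using up by (simp add: Suc walk_fps_Suc[of _ _ g] distrib_right)
    qed
  qed
qed

section \<open>Walks along the initial ascent\<close>

text \<open>A first step down leaves the diagonal for good; in \<open>walk_fps_mult_bessel\<close>
  the weight of the new vertex cancels and \<open>bessel star k\<close> remains. For
  \<open>k = 0\<close> the empty walk supplies this term. A step up reaches the next diagonal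
  vertex.\<close>

lemma diagonal_walk_fps:
  assumes W: "\<And>i h. int i > h \<Longrightarrow> W i h = step_weight h"
  shows "walk_fps W k k * bessel star 0 = bessel star k
    + fps_X * fps_const (W (Suc k) (int (Suc k))) * (walk_fps W (Suc k) (Suc k) * bessel star 0)"
proof (cases k)
  case 0
  then show ?thesis by (simp add: walk_fps_0 algebra_simps)
next
  case (Suc g)
  have "walk_fps W (Suc k) g * bessel star 0 = fps_const (inverse (step_weight (int g))) * bessel star k"
    using walk_fps_off_diagonal[OF W, where h = g and i = "Suc k" and j = 0] walk_fps_mult_bessel[of 0 g star] by (simp add: Suc)
  then have "fps_const (W (Suc k) (int g)) * walk_fps W (Suc k) g * bessel star 0 = bessel star k"
    using step_weight_nonzero[of g] W[of "int g" "Suc k"]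
    by (simp add: Suc mult.assoc)
  then show ?thesis
    by (simp add: Suc walk_fps_Suc[of _ _ g] distrib_right mult.assoc)
qed

text \<open>Iterates \<open>diagonal_walk_fps\<close>; \<open>j\<close> counts the further vertices
  on the diagonal.\<close>

lemma diagonal_walk_fps_nth:
  assumes W: "\<And>i h. int i > h \<Longrightarrow> W i h = step_weight h"
  shows "(walk_fps W k k * bessel star 0) $ n
    = (\<Sum>j\<le>n. (\<Prod>i<j. W (Suc (k + i)) (int (Suc (k + i)))) * bessel star (k + j) $ (n - j))"
proof (induction n arbitrary: k)
  case 0
  show ?case by (subst diagonal_walk_fps[OF W]) (simp_all add: mult.assoc)
next
  case (Suc n)
  let ?W = "\<lambda>i. W i (int i)"
  have "(walk_fps W k k * bessel star 0) $ Suc n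
    = bessel star k $ Suc n + ?W (Suc k) * (walk_fps W (Suc k) (Suc k) * bessel star 0) $ n"
    by (subst diagonal_walk_fps[OF W]) (simp_all add: mult.assoc)
  also have "\<dots> = bessel star k $ Suc n
      + (\<Sum>j\<le>n. (\<Prod>i<Suc j. ?W (Suc (k + i))) * bessel star (k + Suc j) $ (n - j))"
    unfolding Suc.IH sum_distrib_left
    by (subst prod.lessThan_Suc_shift) (simp add: mult_ac)
  also have "\<dots> = (\<Sum>j\<le>Suc n. (\<Prod>i<j. ?W (Suc (k + i))) * bessel star (k + j) $ (Suc n - j))"
    by (subst sum.atMost_Suc_shift) simp
  finally show ?case .
qed

lemma twice_choose_two: "2 * (j choose 2) + j = j * j"
  by (induction j) (simp_all add: numeral_2_eq_2 algebra_simps)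

definition diagonal_weight :: "bool \<Rightarrow> nat \<Rightarrow> 'a" where
  "diagonal_weight star i = q ^ (if star then i else i - 1) / (1 - q ^ (2 * i))"

lemma prod_diagonal_weight:
  "(\<Prod>i<j. diagonal_weight star (Suc i)) = q ^ ((if star then j else 0) + (j choose 2)) / sq.qfact j"
proof (induction j)
  case (Suc j)
  have "Suc j choose 2 = (j choose 2) + j"
    by (simp add: numeral_2_eq_2)
  then show ?case
    unfolding prod.lessThan_Suc Suc.IH
    unfolding diagonal_weight_def qfact_square_Suc
    by (simp add: power_add mult_ac)
qed (simp add: binomial_eq_0)

theorem diagonal_walk_fps_mult_bessel:
  assumes W: "\<And>i h. int i > h \<Longrightarrow> W i h = step_weight h"
    and diagonal: "\<And>i. i > 0 \<Longrightarrow> W i (int i) = diagonal_weight star i"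
  shows "walk_fps W 0 0 * bessel star 0 = 1"
proof (rule fps_ext)
  fix n
  let ?V = "\<lambda>j. q ^ ((if star then j else 0) + (j choose 2)) / sq.qfact j"
  have "(walk_fps W 0 0 * bessel star 0) $ n = (\<Sum>j\<le>n. ?V j * bessel star j $ (n - j))"
    using diagonal_walk_fps_nth[OF W, where k = 0 and star = star and n = n]
    by (simp add: diagonal del: of_nat_Suc flip: prod_diagonal_weight)
  also have "\<dots> = (if n = 0 then 1 else 0)"
  proof (cases star)
    case False
    \<comment> \<open>Both factors contribute \<open>q^(j choose 2)\<close>, which gives the weight
      of the q-binomial theorem in base \<open>q^2\<close>.\<close>
    have "?V j * bessel star j $ (n - j)
        = (-1) ^ n / qfact (2 * n) * ((-1) ^ j * (q\<^sup>2) ^ (j choose 2) * sq.qbin j (n - j))" if "j \<le> n" for j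
    proof -
      obtain i where i: "n = i + j" using \<open>j \<le> n\<close> le_Suc_ex by (metis add.commute)
      have sign: "(-1) ^ i = (-1) ^ n * ((-1) ^ j :: 'a)"
        by (simp add: i power_add mult.assoc flip: power_mult_distrib)
      have square: "(q\<^sup>2) ^ (j choose 2) = q ^ (j choose 2) * q ^ (j choose 2)"
        by (simp add: power2_eq_square power_mult_distrib)
      have "bessel star j $ (n - j) = (-1) ^ i * (q ^ (j choose 2) * sq.qfact n / (sq.qfact i * qfact (2 * n)))"
        using False by (simp add: i bessel_def bessel_coeff_def)
      moreover have "sq.qbin j (n - j) = sq.qfact n / (sq.qfact j * sq.qfact i)"
        by (simp add: i sq.qbin_def add.commute)
      moreover have "?V j = q ^ (j choose 2) / sq.qfact j"
        using False by simp
      ultimately show ?thesis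
        unfolding sign square by (simp only: times_divide_eq_left times_divide_eq_right divide_divide_eq_left mult_ac)
    qed
    then have "(\<Sum>j\<le>n. ?V j * bessel star j $ (n - j))
      = (-1) ^ n / qfact (2 * n) * (\<Sum>j\<le>n. (-1) ^ j * (q\<^sup>2) ^ (j choose 2) * sq.qbin j (n - j))"
      by (simp add: sum_distrib_left)
    then show ?thesis unfolding sq.alternating_qbin_sum' by simp
  next
    case True
    \<comment> \<open>With the star, the exponent is \<open>n * n\<close> plus
      \<open>2 * (i choose 2)\<close> for \<open>i = n - j\<close>, so the sum is taken over the
      complementary index.\<close>
    have "?V (n - i) * bessel star (n - i) $ i
        = q ^ (n * n) / qfact (2 * n) * ((-1) ^ i * (q\<^sup>2) ^ (i choose 2) * sq.qbin i (n - i))" if "i \<le> n" for i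
    proof -
      obtain j where j: "n = i + j" using \<open>i \<le> n\<close> le_Suc_ex by blast
      have "i * (2 * i + 2 * j - 1) + i = 2 * i * i + 2 * i * j"
        by (cases i) (simp_all add: algebra_simps)
      then have "j + (j choose 2) + (i * (2 * i + 2 * j - 1) + (j choose 2)) = n * n + 2 * (i choose 2)"
        using twice_choose_two[of i] twice_choose_two[of j] by (simp add: j algebra_simps)
      then have power: "q ^ (j + (j choose 2)) * (q ^ (i * (2 * i + 2 * j - 1)) * q ^ (j choose 2)) = q ^ (n * n) * (q\<^sup>2) ^ (i choose 2)"
        by (simp only: flip: power_add power_mult)
      have "?V (n - i) * bessel star (n - i) $ i = q ^ (j + (j choose 2)) / sq.qfact j * ((-1) ^ i
          * (q ^ (i * (2 * i + 2 * j - 1)) * (q ^ (j choose 2) * sq.qfact n / (sq.qfact i * qfact (2 * n)))))"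
        using True by (simp add: j bessel_def bessel_coeff_def)
      also have "\<dots> = q ^ (j + (j choose 2)) * (q ^ (i * (2 * i + 2 * j - 1)) * q ^ (j choose 2))
          * ((-1) ^ i * sq.qfact n / (sq.qfact j * sq.qfact i * qfact (2 * n)))"
        by (simp only: times_divide_eq_left times_divide_eq_right divide_divide_eq_left mult_ac)
      also have "\<dots> = q ^ (n * n) / qfact (2 * n) * ((-1) ^ i * (q\<^sup>2) ^ (i choose 2)
          * (sq.qfact n / (sq.qfact i * sq.qfact j)))"
        unfolding power by (simp only: times_divide_eq_left times_divide_eq_right divide_divide_eq_left mult_ac)
      finally show ?thesis by (simp add: j sq.qbin_def)
    qed
    moreover have "(\<Sum>j\<le>n. ?V j * bessel star j $ (n - j)) = (\<Sum>i\<le>n. ?V (n - i) * bessel star (n - i) $ i)"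
      by (rule sum.reindex_bij_witness[of _ "\<lambda>i. n - i" "\<lambda>i. n - i"]) auto
    ultimately have "(\<Sum>j\<le>n. ?V j * bessel star j $ (n - j))
      = q ^ (n * n) / qfact (2 * n) * (\<Sum>i\<le>n. (-1) ^ i * (q\<^sup>2) ^ (i choose 2) * sq.qbin i (n - i))"
      by (simp add: sum_distrib_left)
    then show ?thesis unfolding sq.alternating_qbin_sum' by simp
  qed
  finally show "(walk_fps W 0 0 * bessel star 0) $ n = 1 $ n" by simp
qed

end


section \<open>Permutations with given descent set, as words\<close>

text \<open>Divided by \<open>q_pochhammer q q n\<close>, this is the ribbon Schur function of
  \<open>S\<close> at \<open>1, q, q^2, ...\<close>.\<close>

definition maj_sum :: "'a::comm_ring_1 \<Rightarrow> nat \<Rightarrow> nat set \<Rightarrow> 'a" where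
  "maj_sum q n S = (\<Sum>\<sigma> | \<sigma> permutes {1..n} \<and> descent_set n \<sigma> = S. q ^ maj n (inv \<sigma>))"

abbreviation adjacent_pair :: "nat \<Rightarrow> nat list \<Rightarrow> nat list" where
  "adjacent_pair i w \<equiv> filter (\<lambda>x. x = i \<or> x = Suc i) w"

text \<open>The filtered pair tells which of \<open>i\<close>, \<open>i + 1\<close> comes first, and
  shuffling in letters of another alphabet does not affect it.\<close>

definition descent_words :: "nat \<Rightarrow> nat set \<Rightarrow> nat list set" where
  "descent_words n S = {w \<in> permutations_of_set {1..n}.
     \<forall>i\<in>{1..<n}. adjacent_pair i w = [i, Suc i] \<longleftrightarrow> i \<in> S}"

text \<open>
  The one-line notation of the inverse, read backwards: \<open>\<sigma>\<close> has a descent at \<open>i\<close> iff \<open>i\<close> occurs before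
  \<open>i + 1\<close> in this word.
\<close>

definition inverse_word :: "nat \<Rightarrow> (nat \<Rightarrow> nat) \<Rightarrow> nat list" where
  "inverse_word n \<sigma> = map (inv \<sigma>) (rev [1..<Suc n])"

lemma descent_set_Suc:
  "descent_set (Suc n) \<tau> = descent_set n \<tau> \<union> (if 1 \<le> n \<and> \<tau> n > \<tau> (Suc n) then {n} else {})"
  by (auto simp: descent_set_def less_Suc_eq)

lemma maj_Suc: "maj (Suc n) \<tau> = maj n \<tau> + (if \<tau> n > \<tau> (Suc n) then n else 0)"
proof -
  have "finite (descent_set n \<tau>)" "n \<notin> descent_set n \<tau>"
    by (auto simp: descent_set_def)
  then show ?thesis
    by (auto simp: maj_def descent_set_Suc not_le)
qed

lemma rmaj_eq_maj: "rmaj (map \<tau> (rev [1..<Suc n])) = maj n \<tau>"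
proof (induction n)
  case (Suc n)
  show ?case
  proof (cases n)
    case (Suc m)
    then have "rev [1..<Suc (Suc n)] = Suc n # n # rev [1..<n]" "rev [1..<Suc n] = n # rev [1..<n]"
      by simp_all
    then show ?thesis
      using Suc.IH Suc by (simp add: maj_Suc[of "Suc m"])
  qed (simp add: maj_def descent_set_def)
qed (simp add: maj_def descent_set_def)

lemma filter_upt_pair:
  assumes "m \<le> a" "a < b" "b < n"
  shows "filter (\<lambda>k. k = a \<or> k = b) [m..<n] = [a, b]"
proof -
  have "[m..<n] = [m..<a] @ a # [Suc a..<b] @ b # [Suc b..<n]"
    using assms upt_add_eq_append[of m a "n - a"] upt_add_eq_append[of "Suc a" b "n - b"] by (simp add: upt_conv_Cons)
  moreover have "filter (\<lambda>k. k = a \<or> k = b) [m..<a] = []" "filter (\<lambda>k. k = a \<or> k = b) [Suc a..<b] = []"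
    "filter (\<lambda>k. k = a \<or> k = b) [Suc b..<n] = []"
    using assms by (auto simp: filter_empty_conv)
  ultimately show ?thesis by simp
qed

lemma adjacent_pair_inverse_word:
  assumes \<sigma>: "\<sigma> permutes {1..n}" and i: "i \<in> {1..<n}"
  shows "adjacent_pair i (inverse_word n \<sigma>) = [i, Suc i] \<longleftrightarrow> \<sigma> i > \<sigma> (Suc i)"
proof -
  \<comment> \<open>The letter \<open>i\<close> stands at position \<open>\<sigma> i\<close>;
    positions are read downwards, so the letter with the larger image comes first.\<close>
  have "adjacent_pair i (inverse_word n \<sigma>) = map (inv \<sigma>) (rev (filter (\<lambda>k. k = \<sigma> i \<or> k = \<sigma> (Suc i)) [1..<Suc n]))"
    unfolding inverse_word_def filter_map rev_filter comp_def
    using permutes_inv_eq[OF \<sigma>] by (metis (no_types, lifting))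
  moreover have "\<sigma> i \<in> {1..n}" "\<sigma> (Suc i) \<in> {1..n}"
    using i by (simp_all only: permutes_in_image[OF \<sigma>]) auto
  moreover have "\<sigma> i \<noteq> \<sigma> (Suc i)"
    using permutes_inj[OF \<sigma>] by (metis injD n_not_Suc_n)
  ultimately show ?thesis
    using filter_upt_pair[of 1 "\<sigma> i" "\<sigma> (Suc i)" "Suc n"] filter_upt_pair[of 1 "\<sigma> (Suc i)" "\<sigma> i" "Suc n"]
    by (cases "\<sigma> i < \<sigma> (Suc i)") (auto simp: permutes_inverses[OF \<sigma>] disj_commute simp del: upt_Suc)
qed

lemma bij_betw_inverse_word:
  "bij_betw (inverse_word n) {\<sigma>. \<sigma> permutes {1..n}} (permutations_of_set {1..n})"
proof -
  have inj: "inj_on (inverse_word n) {\<sigma>. \<sigma> permutes {1..n}}"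
  proof (rule inj_onI; clarify)
    fix \<sigma> \<rho> assume p: "\<sigma> permutes {1..n}" "\<rho> permutes {1..n}" and "inverse_word n \<sigma> = inverse_word n \<rho>"
    then have "inv \<sigma> k = inv \<rho> k" if "k \<in> {1..n}" for k
      using that by (auto simp: inverse_word_def simp flip: rev_map simp del: upt_Suc)
    then have "inv \<sigma> = inv \<rho>"
      using p[THEN permutes_inv] by (metis ext permutes_not_in)
    then show "\<sigma> = \<rho>" using p by (metis permutes_inv_inv)
  qed
  moreover have "inverse_word n ` {\<sigma>. \<sigma> permutes {1..n}} = permutations_of_set {1..n}"
  proof (rule card_subset_eq)
    show "inverse_word n ` {\<sigma>. \<sigma> permutes {1..n}} \<subseteq> permutations_of_set {1..n}"
    proof clarify
      fix \<sigma> assume "\<sigma> permutes {1..n}"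
      then have "inv \<sigma> permutes {1..n}" by (rule permutes_inv)
      then show "inverse_word n \<sigma> \<in> permutations_of_set {1..n}"
        using permutes_image[of "inv \<sigma>" "{1..n}"] permutes_inj_on[of "inv \<sigma>"]
        by (auto simp: inverse_word_def permutations_of_set_def distinct_map atLeastLessThanSuc_atLeastAtMost simp del: upt_Suc)
    qed
    show "card (inverse_word n ` {\<sigma>. \<sigma> permutes {1..n}}) = card (permutations_of_set {1..n})"
      using card_permutations[of "{1..n}" n] by (simp only: card_image[OF inj] card_permutations_of_set finite_atLeastAtMost card_atLeastAtMost) simp
  qed simp
  ultimately show ?thesis by (simp add: bij_betw_def)
qed

text \<open>\<open>descent_words\<close> constrains only positions in \<open>{1..<n}\<close>, so
  \<open>S\<close> must lie there for the two conditions to agree.\<close>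

lemma maj_sum_words:
  assumes "S \<subseteq> {1..<n}"
  shows "maj_sum q n S = (\<Sum>w\<in>descent_words n S. q ^ rmaj w)"
proof -
  have iff: "inverse_word n \<sigma> \<in> descent_words n S \<longleftrightarrow> descent_set n \<sigma> = S" if "\<sigma> permutes {1..n}" for \<sigma>
  proof -
    have "inverse_word n \<sigma> \<in> permutations_of_set {1..n}"
      using bij_betw_inverse_word that by (auto simp: bij_betw_def)
    then show ?thesis
      using assms adjacent_pair_inverse_word[OF that] by (auto simp: descent_words_def descent_set_def)
  qed
  have "bij_betw (inverse_word n) {\<sigma>. \<sigma> permutes {1..n} \<and> descent_set n \<sigma> = S} (descent_words n S)"
    unfolding bij_betw_def
  proof
    show "inj_on (inverse_word n) {\<sigma>. \<sigma> permutes {1..n} \<and> descent_set n \<sigma> = S}"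
      using bij_betw_inverse_word[of n] by (auto simp: bij_betw_def inj_on_def)
    have "w \<in> inverse_word n ` {\<sigma>. \<sigma> permutes {1..n}}" if "w \<in> descent_words n S" for w
      using that bij_betw_inverse_word[of n] by (auto simp: bij_betw_def descent_words_def)
    then show "inverse_word n ` {\<sigma>. \<sigma> permutes {1..n} \<and> descent_set n \<sigma> = S} = descent_words n S"
      using iff by blast
  qed
  from sum.reindex_bij_betw[OF this, of "\<lambda>w. q ^ rmaj w"] show ?thesis
    by (simp only: maj_sum_def inverse_word_def rmaj_eq_maj)
qed

lemma adjacent_pair_shift:
  "adjacent_pair (a + i) (map ((+) a) v) = [a + i, Suc (a + i)] \<longleftrightarrow> adjacent_pair i v = [i, Suc i]"
proof -
  have "adjacent_pair (a + i) (map ((+) a) v) = map ((+) a) (adjacent_pair i v)"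
    unfolding filter_map comp_def by (intro arg_cong[where f = "map _"] filter_cong) auto
  then show ?thesis
    using inj_map_eq_map[of "(+) a" "adjacent_pair i v" "[i, Suc i]"] by simp
qed

lemma rmaj_shift: "rmaj (map ((+) a) v) = rmaj v"
  by (induction v rule: rmaj.induct) auto

definition shifted_union :: "nat \<Rightarrow> nat set \<Rightarrow> nat set \<Rightarrow> nat set" where
  "shifted_union a S T = S \<union> (+) a ` T"

text \<open>For \<open>i \<noteq> a\<close> the letters \<open>i\<close>, \<open>i + 1\<close> lie
  in one alphabet, and restricting the shuffle to it returns \<open>u\<close> or the shifted
  \<open>v\<close>. Only the pair \<open>a\<close>, \<open>a + 1\<close> straddles both.\<close>

lemma shuffle_descents:
  assumes a: "a > 0" and S: "S \<subseteq> {1..<a}" and T: "T \<subseteq> {1..<b}"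
    and u: "u \<in> permutations_of_set {1..a}" and v: "v \<in> permutations_of_set {1..b}"
    and w: "w \<in> shuffles u (map ((+) a) v)"
  shows "w \<in> permutations_of_set {1..a + b}"
    and "(\<forall>i\<in>{1..<a + b} - {a}. adjacent_pair i w = [i, Suc i] \<longleftrightarrow> i \<in> shifted_union a S T)
      \<longleftrightarrow> u \<in> descent_words a S \<and> v \<in> descent_words b T"
    and "filter (\<lambda>x. x \<le> a) w = u" and "filter (\<lambda>x. \<not> x \<le> a) w = map ((+) a) v"
proof -
  have setu: "set u = {1..a}" "distinct u" and setv: "set v = {1..b}" "distinct v"
    using u v by (auto simp: permutations_of_set_def)
  have "set w = {1..a} \<union> (+) a ` {1..b}"
    using w setu setv by (simp add: set_shuffles)
  moreover have "(+) a ` {1..b} = {Suc a..a + b}"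
    by (simp add: image_add_atLeastAtMost)
  moreover have "distinct w"
    by (rule distinct_disjoint_shuffles[OF _ _ _ w]) (use setu setv in \<open>auto simp: distinct_map\<close>)
  ultimately show "w \<in> permutations_of_set {1..a + b}"
    using a by (auto simp: permutations_of_set_def)
  have "filter (\<lambda>x. x \<le> a) w \<in> shuffles (filter (\<lambda>x. x \<le> a) u) (filter (\<lambda>x. x \<le> a) (map ((+) a) v))"
    using w by (auto simp flip: filter_shuffles)
  moreover have "filter (\<lambda>x. x \<le> a) u = u" "filter (\<lambda>x. x \<le> a) (map ((+) a) v) = []"
    using setu setv by (auto simp: filter_id_conv filter_empty_conv)
  ultimately show fu: "filter (\<lambda>x. x \<le> a) w = u" by simp
  have "filter (\<lambda>x. \<not> x \<le> a) w \<in> shuffles (filter (\<lambda>x. \<not> x \<le> a) u) (filter (\<lambda>x. \<not> x \<le> a) (map ((+) a) v))"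
    using w by (auto simp flip: filter_shuffles)
  moreover have "filter (\<lambda>x. \<not> x \<le> a) u = []" "filter (\<lambda>x. \<not> x \<le> a) (map ((+) a) v) = map ((+) a) v"
    using setu setv by (auto simp: filter_id_conv filter_empty_conv)
  ultimately show fv: "filter (\<lambda>x. \<not> x \<le> a) w = map ((+) a) v" by simp
  have low: "adjacent_pair i w = adjacent_pair i u" if "i < a" for i
    unfolding fu[symmetric] filter_filter using that by (intro filter_cong) auto
  have high: "adjacent_pair i w = adjacent_pair i (map ((+) a) v)" if "i > a" for i
    unfolding fv[symmetric] filter_filter using that by (intro filter_cong) auto
  have split: "{1..<a + b} - {a} = {1..<a} \<union> (+) a ` {1..<b}"
    using a by (auto simp: image_add_atLeastLessThan)
  have "i \<in> shifted_union a S T \<longleftrightarrow> i \<in> S" if "i < a" for i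
    using that by (auto simp: shifted_union_def)
  moreover have "a + i \<in> shifted_union a S T \<longleftrightarrow> i \<in> T" if "i > 0" for i
    using that S by (auto simp: shifted_union_def)
  ultimately show "(\<forall>i\<in>{1..<a + b} - {a}. adjacent_pair i w = [i, Suc i] \<longleftrightarrow> i \<in> shifted_union a S T)
      \<longleftrightarrow> u \<in> descent_words a S \<and> v \<in> descent_words b T"
    unfolding split descent_words_def using u v
    by (simp add: ball_Un low high adjacent_pair_shift del: image_add_atLeastLessThan image_add_atLeastLessThan')
qed

context generic_q
begin

text \<open>Shuffling words of the two factors leaves position \<open>a\<close> free, hence the two
  terms on the right; \<open>shuffle_sum\<close> supplies the Gaussian binomial.\<close>

lemma maj_sum_mult:
  assumes a: "a > 0" and b: "b > 0" and S: "S \<subseteq> {1..<a}" and T: "T \<subseteq> {1..<b}"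
  shows "qbin a b * maj_sum q a S * maj_sum q b T
    = maj_sum q (a + b) (shifted_union a S T) + maj_sum q (a + b) (insert a (shifted_union a S T))"
proof -
  let ?U = "shifted_union a S T" and ?v = "map ((+) a)"
  let ?A = "descent_words a S" and ?B = "descent_words b T"
  have "?U \<subseteq> {1..<a + b} - {a}"
    using S T by (fastforce simp: shifted_union_def)
  then have "maj_sum q (a + b) ?U + maj_sum q (a + b) (insert a ?U)
    = (\<Sum>w\<in>descent_words (a + b) ?U. q ^ rmaj w) + (\<Sum>w\<in>descent_words (a + b) (insert a ?U). q ^ rmaj w)"
    using a b by (subst (1 2) maj_sum_words) auto
  also have "\<dots> = (\<Sum>w\<in>descent_words (a + b) ?U \<union> descent_words (a + b) (insert a ?U). q ^ rmaj w)"
  proof (rule sum.union_disjoint[symmetric])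
    show "descent_words (a + b) ?U \<inter> descent_words (a + b) (insert a ?U) = {}"
      using \<open>?U \<subseteq> _\<close> a b by (fastforce simp: descent_words_def)
  qed (simp_all add: descent_words_def)
  \<comment> \<open>The two sets differ only in the condition at \<open>a\<close>, which their union
    drops.\<close>
  also have "descent_words (a + b) ?U \<union> descent_words (a + b) (insert a ?U)
    = {w \<in> permutations_of_set {1..a + b}. \<forall>i\<in>{1..<a + b} - {a}. adjacent_pair i w = [i, Suc i] \<longleftrightarrow> i \<in> ?U}"
    (is "_ = ?W")
    using \<open>?U \<subseteq> _\<close> unfolding descent_words_def by blast
  also have "(\<Sum>w\<in>?W. q ^ rmaj w) = (\<Sum>(u, v, w)\<in>(SIGMA u:?A. SIGMA v:?B. shuffles u (?v v)). q ^ rmaj w)"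
  \<comment> \<open>A word is determined by its small letters, its large letters shifted down, and
    the way it shuffles them.\<close>
  proof (rule sum.reindex_bij_witness[where i = "\<lambda>(u, v, w). w" and j = "\<lambda>w. (filter (\<lambda>x. x \<le> a) w, map (\<lambda>x. x - a) (filter (\<lambda>x. \<not> x \<le> a) w), w)"])
    fix w assume w: "w \<in> ?W"
    define u v where "u = filter (\<lambda>x. x \<le> a) w" and "v = map (\<lambda>x. x - a) (filter (\<lambda>x. \<not> x \<le> a) w)"
    have v: "?v v = filter (\<lambda>x. \<not> x \<le> a) w"
      unfolding v_def map_map by (rule map_idI) auto
    have sh: "w \<in> shuffles u (?v v)"
      unfolding v u_def by (rule partition_in_shuffles)
    have "set u = {1..a}" "distinct u"
      using w by (auto simp: u_def permutations_of_set_def)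
    moreover have "distinct (?v v)"
      unfolding v using w by (simp add: permutations_of_set_def)
    then have "distinct v" by (simp add: distinct_map)
    moreover have "set v = {1..b}"
    proof -
      have "(+) a ` set v = {Suc a..a + b}"
        using arg_cong[OF v, of set] w by (auto simp: permutations_of_set_def)
      also have "\<dots> = (+) a ` {1..b}" by (simp add: image_add_atLeastAtMost)
      finally show ?thesis
        using inj_image_eq_iff[of "(+) a" "set v" "{1..b}"] by (simp del: image_add_atLeastAtMost image_add_atLeastAtMost')
    qed
    ultimately have perm: "u \<in> permutations_of_set {1..a}" "v \<in> permutations_of_set {1..b}"
      by (simp_all add: permutations_of_set_def)
    have "u \<in> ?A" "v \<in> ?B"
      using shuffle_descents(2)[OF a S T perm sh] w by simp_all
    then show "(filter (\<lambda>x. x \<le> a) w, map (\<lambda>x. x - a) (filter (\<lambda>x. \<not> x \<le> a) w), w)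
        \<in> (SIGMA u:?A. SIGMA v:?B. shuffles u (?v v))"
      using sh unfolding u_def[symmetric] v_def[symmetric] by simp
  next
    fix t assume "t \<in> (SIGMA u:?A. SIGMA v:?B. shuffles u (?v v))"
    then obtain u v w where t: "t = (u, v, w)" and uv: "u \<in> ?A" "v \<in> ?B" and w: "w \<in> shuffles u (?v v)"
      by auto
    have perm: "u \<in> permutations_of_set {1..a}" "v \<in> permutations_of_set {1..b}"
      using uv by (simp_all add: descent_words_def)
    note * = shuffle_descents[OF a S T perm w]
    show "(\<lambda>(u, v, w). w) t \<in> ?W"
      using * uv by (simp add: t)
    show "(\<lambda>w. (filter (\<lambda>x. x \<le> a) w, map (\<lambda>x. x - a) (filter (\<lambda>x. \<not> x \<le> a) w), w)) ((\<lambda>(u, v, w). w) t) = t"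
      by (simp add: t *(3,4) comp_def)
  qed auto
  also have "\<dots> = (\<Sum>u\<in>?A. \<Sum>v\<in>?B. \<Sum>w\<in>shuffles u (?v v). q ^ rmaj w)"
    by (simp add: sum.Sigma descent_words_def)
  also have "\<dots> = (\<Sum>u\<in>?A. \<Sum>v\<in>?B. q ^ rmaj u * q ^ rmaj v * qbin a b)"
  proof (intro sum.cong refl)
    fix u v assume "u \<in> ?A" "v \<in> ?B"
    then have "set u = {1..a}" "length u = a" "set v = {1..b}" "length v = b"
      by (auto simp: descent_words_def permutations_of_set_def distinct_card[symmetric])
    then show "(\<Sum>w\<in>shuffles u (?v v). q ^ rmaj w) = q ^ rmaj u * q ^ rmaj v * qbin a b"
      by (subst shuffle_sum) (auto simp: rmaj_shift power_add)
  qed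
  also have "\<dots> = qbin a b * (\<Sum>u\<in>?A. q ^ rmaj u) * (\<Sum>v\<in>?B. q ^ rmaj v)"
    by (simp add: sum_distrib_left sum_distrib_right mult_ac)
  finally show ?thesis
    using S T by (simp add: maj_sum_words)
qed

end


section \<open>Monotone blocks and the recurrence for alternating permutations\<close>

text \<open>The values form a list sorted upwards or downwards, which is determined by its set of
  elements.\<close>

lemma maj_sum_block_cong:
  assumes \<sigma>: "\<sigma> permutes {1..n}" "descent_set n \<sigma> = S" and \<rho>: "\<rho> permutes {1..n}" "descent_set n \<rho> = S"
    and S: "S = {} \<or> S = {1..<n}"
  shows "\<sigma> = \<rho>"
proof -
  have inj: "\<pi> i \<noteq> \<pi> (Suc i)" if "\<pi> permutes {1..n}" for \<pi> i
    using permutes_inj[OF that] by (metis injD n_not_Suc_n)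
  have set: "set (map \<pi> [1..<Suc n]) = {1..n}" "distinct (map \<pi> [1..<Suc n])" if "\<pi> permutes {1..n}" for \<pi>
    using permutes_image[OF that] permutes_inj_on[OF that, of "{1..n}"]
    by (simp_all add: distinct_map atLeastLessThanSuc_atLeastAtMost del: upt_Suc)
  have "map \<sigma> [1..<Suc n] = map \<rho> [1..<Suc n]"
  proof (cases "S = {}")
    case True
    have "sorted (map \<pi> [1..<Suc n])" if "\<pi> permutes {1..n}" "descent_set n \<pi> = S" for \<pi>
    proof -
      have "\<pi> i \<le> \<pi> (Suc i)" if "i \<in> {1..<n}" for i
        using that \<open>descent_set n \<pi> = S\<close> True by (auto simp: descent_set_def not_less)
      then show ?thesis
        unfolding sorted_iff_nth_Suc by (auto simp del: upt_Suc)
    qed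
    then show ?thesis
      using sorted_distinct_set_unique set \<sigma> \<rho> by metis
  next
    case False
    have "sorted (rev (map \<pi> [1..<Suc n]))" if "\<pi> permutes {1..n}" "descent_set n \<pi> = S" for \<pi>
    proof -
      have "\<pi> i > \<pi> (Suc i)" if "i \<in> {1..<n}" for i
      proof -
        have "i \<in> descent_set n \<pi>"
          using that \<open>descent_set n \<pi> = S\<close> S False by blast
        then show ?thesis by (simp add: descent_set_def)
      qed
      then show ?thesis
        unfolding sorted_rev_iff_nth_Suc by (auto simp: less_imp_le simp del: upt_Suc)
    qed
    then have "rev (map \<sigma> [1..<Suc n]) = rev (map \<rho> [1..<Suc n])"
      using sorted_distinct_set_unique set \<sigma> \<rho> by (metis distinct_rev set_rev)
    then show ?thesis by simp
  qed
  then have "\<sigma> i = \<rho> i" if "i \<in> {1..n}" for i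
    using that by (auto simp del: upt_Suc)
  then show ?thesis
    using \<sigma>(1) \<rho>(1) by (metis ext permutes_not_in)
qed

lemma maj_sum_single:
  assumes "\<rho> permutes {1..n}" "descent_set n \<rho> = S" "S = {} \<or> S = {1..<n}"
  shows "maj_sum q n S = q ^ maj n (inv \<rho>)"
proof -
  have "{\<sigma>. \<sigma> permutes {1..n} \<and> descent_set n \<sigma> = S} = {\<rho>}"
    using maj_sum_block_cong[of _ n S \<rho>] assms by blast
  then show ?thesis by (simp add: maj_sum_def)
qed

lemma maj_sum_empty: "maj_sum q n {} = 1"
proof -
  have "maj_sum q n {} = q ^ maj n (inv id)"
    by (rule maj_sum_single) (auto simp: permutes_id descent_set_def)
  then show ?thesis by (simp add: maj_def descent_set_def)
qed

lemma maj_sum_full: "maj_sum q n {1..<n} = q ^ (n choose 2)"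
proof -
  \<comment> \<open>The reversal is an involution, so its inverse also has every position as a
    descent.\<close>
  define \<rho> where "\<rho> i = (if i \<in> {1..n} then Suc n - i else i)" for i
  have \<rho>: "\<rho> (\<rho> i) = i" for i by (auto simp: \<rho>_def)
  have "\<rho> permutes {1..n}"
    by (rule bij_imp_permutes, rule bij_betw_byWitness[where f' = \<rho>]) (simp_all only: \<rho>, auto simp: \<rho>_def)
  moreover have descents: "descent_set n \<rho> = {1..<n}"
    by (auto simp: descent_set_def \<rho>_def)
  ultimately have "maj_sum q n {1..<n} = q ^ maj n (inv \<rho>)"
    by (rule maj_sum_single) simp
  moreover have "inv \<rho> = \<rho>"
    using \<rho> by (intro inv_equality)
  moreover have "\<Sum>{1..<n} = n choose 2"
    by (induction n) (auto simp: numeral_2_eq_2 atLeastLessThanSuc)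
  ultimately show ?thesis
    by (simp add: maj_def descents)
qed

lemma maj_sum_0: "maj_sum q 0 S = (if S = {} then 1 else 0)"
  using maj_sum_empty[of q 0] by (auto simp: maj_sum_def descent_set_def)

definition alternating_set :: "bool \<Rightarrow> nat \<Rightarrow> nat set" where
  "alternating_set star n = {i \<in> {1..<n}. odd i \<longleftrightarrow> star}"

text \<open>
  For even \<open>k\<close>, the alternating pattern after position \<open>k\<close>, preceded by a monotone block of length \<open>k\<close>;
  position \<open>k\<close> itself also follows the alternating pattern. Alternating permutations (starred) need a
  decreasing block, reverse alternating ones an increasing block.
\<close>

definition mixed_set :: "bool \<Rightarrow> nat \<Rightarrow> nat \<Rightarrow> nat set" where
  "mixed_set star n k = {i \<in> {1..<n}. if i < k then star else if i = k then \<not> star else (odd i \<longleftrightarrow> star)}"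

abbreviation block_set :: "bool \<Rightarrow> nat \<Rightarrow> nat set" where
  "block_set star n \<equiv> (if star then {1..<n} else {})"

lemma maj_sum_block: "maj_sum q n (block_set star n) = (if star then q ^ (n choose 2) else 1)"
  using maj_sum_empty[of q n] maj_sum_full[of q n] by simp

lemma sum_alternating_telescope:
  fixes r :: "nat \<Rightarrow> 'a::comm_ring_1"
  shows "(\<Sum>j\<le>n. (-1) ^ j * (r j + r (Suc j))) = r 0 + (-1) ^ n * r (Suc n)"
  by (induction n) (simp_all add: algebra_simps)

context generic_q
begin

interpretation sq: generic_q "q\<^sup>2"
  by (rule generic_q_square)

text \<open>\<open>maj_sum_mult\<close> splits each inner product into the terms of two mixed sets;
  neighbouring \<open>j\<close> share one of them with opposite signs, so the sum
  telescopes.\<close>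

lemma maj_sum_alternating_recurrence:
  assumes n: "n > 0"
  shows "(\<Sum>j\<le>n. (-1) ^ j * (qbin (2 * j) (2 * n - 2 * j) * maj_sum q (2 * j) (block_set star (2 * j))
    * maj_sum q (2 * n - 2 * j) (alternating_set star (2 * n - 2 * j)))) = 0"
proof -
  \<comment> \<open>The value 0 outside \<open>1..n\<close> covers \<open>j = 0\<close> and
    \<open>j = n\<close>, where one factor is empty and the product is a single term.\<close>
  define r where "r j = (if 1 \<le> j \<and> j \<le> n then maj_sum q (2 * n) (mixed_set star (2 * n) (2 * j)) else 0)" for j
  have "qbin (2 * j) (2 * n - 2 * j) * maj_sum q (2 * j) (block_set star (2 * j))
    * maj_sum q (2 * n - 2 * j) (alternating_set star (2 * n - 2 * j)) = r j + r (Suc j)" if "j \<le> n" for j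
  proof -
    consider "j = 0" | "j = n" | "0 < j" "j < n"
      using \<open>j \<le> n\<close> by force
    then show ?thesis
    proof cases
      case 1
      \<comment> \<open>A block of length 2 already follows the alternating pattern.\<close>
      have "alternating_set star (2 * n) = mixed_set star (2 * n) 2"
        by (auto simp: alternating_set_def mixed_set_def less_2_cases_iff)
      then show ?thesis using 1 n by (simp add: r_def maj_sum_0)
    next
      case 2
      have block: "block_set star (2 * n) = mixed_set star (2 * n) (2 * n)"
        by (auto simp: mixed_set_def)
      show ?thesis unfolding 2 block using n by (simp add: r_def maj_sum_0 alternating_set_def)
    next
      case 3
      define b where "b = 2 * n - 2 * j"
      have b: "b > 0" "even b" and ab: "2 * j + b = 2 * n" using 3 by (simp_all add: b_def)
      let ?U = "shifted_union (2 * j) (block_set star (2 * j)) (alternating_set star b)"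
      have U: "i \<in> ?U \<longleftrightarrow> (if i < 2 * j then star \<and> i > 0 else i > 2 * j \<and> i < 2 * n \<and> (odd i \<longleftrightarrow> star))" for i
      proof (cases "i \<le> 2 * j")
        case False
        then obtain k where "i = 2 * j + k" "k > 0" using less_imp_add_positive not_le by metis
        then show ?thesis using ab by (auto simp: shifted_union_def alternating_set_def)
      qed (auto simp: shifted_union_def alternating_set_def)
      \<comment> \<open>The two mixed sets differ only at \<open>2 * j\<close>, since
        \<open>2 * j + 1\<close> follows the block and the alternating pattern alike;
        \<open>star\<close> decides which set contains \<open>2 * j\<close>.\<close>
      have sets: "{?U, insert (2 * j) ?U} = {mixed_set star (2 * n) (2 * j), mixed_set star (2 * n) (2 * Suc j)}"
        "?U \<noteq> insert (2 * j) ?U"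
      proof -
        have less_Suc: "i < 2 * Suc j \<longleftrightarrow> i < 2 * j \<or> i = 2 * j \<or> i = 2 * j + 1" for i by auto
        show "?U \<noteq> insert (2 * j) ?U" using U[of "2 * j"] by auto
        show "{?U, insert (2 * j) ?U} = {mixed_set star (2 * n) (2 * j), mixed_set star (2 * n) (2 * Suc j)}"
        proof (cases star)
          case True
          have "?U = mixed_set star (2 * n) (2 * j)"
            using 3 U True by (auto simp: set_eq_iff mixed_set_def)
          moreover have "insert (2 * j) ?U = mixed_set star (2 * n) (2 * Suc j)"
            unfolding set_eq_iff insert_iff U mixed_set_def less_Suc using 3 True
            by (auto elim!: oddE)
          ultimately show ?thesis by simp
        next
          case False
          have "insert (2 * j) ?U = mixed_set star (2 * n) (2 * j)"
            using 3 U False by (auto simp: set_eq_iff mixed_set_def)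
          moreover have "?U = mixed_set star (2 * n) (2 * Suc j)"
            unfolding set_eq_iff insert_iff U mixed_set_def less_Suc using 3 False
            by (auto elim!: evenE)
          ultimately show ?thesis by auto
        qed
      qed
      have "qbin (2 * j) b * maj_sum q (2 * j) (block_set star (2 * j)) * maj_sum q b (alternating_set star b)
        = maj_sum q (2 * n) ?U + maj_sum q (2 * n) (insert (2 * j) ?U)"
        unfolding ab[symmetric]
        by (rule maj_sum_mult) (use 3 b in \<open>auto simp: alternating_set_def\<close>)
      also have "\<dots> = r j + r (Suc j)"
        using sets 3 unfolding doubleton_eq_iff by (auto simp: r_def add.commute)
      finally show ?thesis unfolding b_def .
    qed
  qed
  then show ?thesis
    using sum_alternating_telescope[of r n] by (simp add: r_def)
qed

section \<open>Comparison of the two generating functions\<close>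

text \<open>A q-secant series, with \<open>fps_X\<close> standing for the square of its
  variable.\<close>

definition euler_fps :: "bool \<Rightarrow> 'a fps" where
  "euler_fps star = Abs_fps (\<lambda>n. maj_sum q (2 * n) (alternating_set star (2 * n)) / qfact (2 * n))"

lemma bessel_mult_euler_fps: "bessel star 0 * euler_fps star = 1"
proof (rule fps_ext)
  fix n
  let ?t = "\<lambda>j. qbin (2 * j) (2 * n - 2 * j) * maj_sum q (2 * j) (block_set star (2 * j))
    * maj_sum q (2 * n - 2 * j) (alternating_set star (2 * n - 2 * j))"
  have "bessel star 0 $ j * euler_fps star $ (n - j) = inverse (qfact (2 * n)) * ((-1) ^ j * ?t j)" if "j \<le> n" for j
  proof -
    \<comment> \<open>With the star, the power of \<open>q\<close> in \<open>bessel_coeff\<close> is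
      the major index of a decreasing block of length \<open>2 * j\<close>.\<close>
    have "j * (2 * j - 1) = (2 * j) choose 2"
      by (cases j) (simp_all add: choose_two algebra_simps)
    moreover have "2 * j + (2 * n - 2 * j) = 2 * n" "2 * (n - j) = 2 * n - 2 * j"
      using that by simp_all
    ultimately show ?thesis
      unfolding maj_sum_block
      by (simp add: bessel_def bessel_coeff_def euler_fps_def qbin_def binomial_eq_0
          field_simps del: mult_Suc_right)
  qed
  then have "(bessel star 0 * euler_fps star) $ n = inverse (qfact (2 * n)) * (\<Sum>j\<le>n. (-1) ^ j * ?t j)"
    by (simp add: fps_mult_nth atMost_atLeast0 sum_distrib_left)
  also have "\<dots> = (if n = 0 then 1 else 0)"
  proof (cases "n = 0")
    case True
    then show ?thesis by (cases star) (simp_all add: maj_sum_0 alternating_set_def)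
  next
    case False
    then show ?thesis by (simp only: maj_sum_alternating_recurrence mult_zero_right if_False)
  qed
  finally show "(bessel star 0 * euler_fps star) $ n = 1 $ n" by simp
qed

text \<open>\<open>bessel star 0\<close> is inverse to both the walk series and
  \<open>euler_fps star\<close>, so these agree.\<close>

theorem sum_dyck_paths:
  assumes W: "\<And>i h. int i > h \<Longrightarrow> W i h = step_weight h"
    and diagonal: "\<And>i. i > 0 \<Longrightarrow> W i (int i) = diagonal_weight star i"
  shows "(\<Sum>h\<in>dyck_paths n. \<Prod>i=1..2 * n. W i (h ! i))
    = maj_sum q (2 * n) (alternating_set star (2 * n)) / qfact (2 * n)"
proof -
  have inverse: "walk_fps W 0 0 * bessel star 0 = 1"
    by (rule diagonal_walk_fps_mult_bessel) (simp_all add: W diagonal)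
  have "walk_fps W 0 0 = (walk_fps W 0 0 * bessel star 0) * euler_fps star"
    by (simp only: mult.assoc bessel_mult_euler_fps mult_1_right)
  also have "\<dots> = euler_fps star"
    unfolding inverse by simp
  finally have "walk_fps W 0 0 $ n = euler_fps star $ n" by simp
  then show ?thesis
    using sum_walks[where h = 0 and m = "2 * n" and W = W and i = 0] by (simp add: walk_fps_def euler_fps_def dyck_paths_eq_walks)
qed

end

section \<open>Specialization to the indeterminate\<close>

lemma indet_power: "indet ^ i = Fract ([:0, 1:] ^ i) 1"
  by (induction i) (simp_all add: indet_def One_fract_def)

interpretation indet: generic_q indet
proof
  show "indet \<noteq> 0"
    by (simp add: indet_def Zero_fract_def eq_fract)
  fix i :: nat assume "i > 0"
  have "degree ([:0, 1 :: rat:] ^ i) = i"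
    by (simp add: degree_power_eq)
  then have "[:0, 1 :: rat:] ^ i \<noteq> 1" using \<open>i > 0\<close> by auto
  then show "indet ^ i \<noteq> 1"
    unfolding indet_power by (simp add: One_fract_def eq_fract)
qed

theorem theorem3p1:
  fixes n :: nat and q :: "rat poly fract"
  assumes q: "q = indet"
  shows "(\<Sum>h\<in>dyck_paths n. \<Prod>i=1..2 * n.
            q powi (h ! i) / (1 - q powi (2 * h ! i + 1 - kdelta (h ! i) (int i))))
          = Estar (2 * n) q / q_pochhammer q q (2 * n)
       \<and> (\<Sum>h\<in>dyck_paths n. \<Prod>i=1..2 * n.
            q powi (h ! i - kdelta (h ! i) (int i))
              / (1 - q powi (2 * h ! i + 1 - kdelta (h ! i) (int i))))
          = E (2 * n) q / q_pochhammer q q (2 * n)"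
proof
  \<comment> \<open>These are the exponents on the diagonal, where the delta is 1; weighted vertices
    have \<open>i > 0\<close>, so \<open>i - 1\<close> is exact.\<close>
  have powi: "indet powi (2 * int i) = indet ^ (2 * i)" "i > 0 \<Longrightarrow> indet powi (int i - 1) = indet ^ (i - 1)" for i
    using power_int_of_nat[of indet "2 * i"] power_int_of_nat[of indet "i - 1"] by (simp_all add: of_nat_diff)
  have "maj_sum q (2 * n) (alternating_set True (2 * n)) = Estar (2 * n) q"
    by (simp add: maj_sum_def alternating_set_def Estar_def Alt_def)
  then show "(\<Sum>h\<in>dyck_paths n. \<Prod>i=1..2 * n.
            q powi (h ! i) / (1 - q powi (2 * h ! i + 1 - kdelta (h ! i) (int i))))
          = Estar (2 * n) q / q_pochhammer q q (2 * n)"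
    using indet.sum_dyck_paths[where star = True and n = n
        and W = "\<lambda>i h. q powi h / (1 - q powi (2 * h + 1 - kdelta h (int i)))"]
    by (simp add: q kdelta_def indet.step_weight_def indet.diagonal_weight_def powi)
  have "maj_sum q (2 * n) (alternating_set False (2 * n)) = E (2 * n) q"
    by (simp add: maj_sum_def alternating_set_def E_def RevAlt_def)
  then show "(\<Sum>h\<in>dyck_paths n. \<Prod>i=1..2 * n.
            q powi (h ! i - kdelta (h ! i) (int i))
              / (1 - q powi (2 * h ! i + 1 - kdelta (h ! i) (int i))))
          = E (2 * n) q / q_pochhammer q q (2 * n)"
    using indet.sum_dyck_paths[where star = False and n = n
        and W = "\<lambda>i h. q powi (h - kdelta h (int i)) / (1 - q powi (2 * h + 1 - kdelta h (int i)))"]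
    by (simp add: q kdelta_def indet.step_weight_def indet.diagonal_weight_def powi)
qed

end
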